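(* Let $\mathcal{M}$ be a finite set of ground terms and $E$ a finite set of (possibly non-ground) equations such that $\mathrm{gnd}_{\mathcal{M}}(s\approx t)\neq\emptyset$ for every $s\approx t\in E$. Consider any run of the calculus $\Rightarrow_{\mathrm{CC}(\mathcal{X})}$ (rules Merge, Deduction, Subsumption) starting from the initial state for $E$, and assume there is a ground term $\alpha\in\mathcal{M}$ such that $\mathcal{M}$ is $\Pi$-closed for $\alpha$ for every state $\Pi$ of the run. Then the run reaches (after finitely many steps) a state where no rule of $\Rightarrow_{\mathrm{CC}(\mathcal{X})}$ is applicable anymore.
   Context: **Terms.** $\Omega$ is a finite set of function symbols with arities, containing at least one constant and one non-constant symbol; $\mathcal{X}$ is an infinite set of variables; $\mathcal{T}(\Omega,\mathcal{X})$ is the set of terms. The only predicate symbol is equality $\approx$. A term, equation etc. is ground if it contains no variable. A substitution is grounding for an object if applying it makes the object ground. $\mathrm{gnd}_{\mathcal{M}}(s\approx t)$ is the set of all ground instances $s\sigma\approx t\sigma$ with $s\sigma,t\sigma\in\mathcal{M}$. Mgus are idempotent and introduce no fresh variables. **Constrained terms and classes.** A constraint $\Gamma$ is a finite conjunction of atoms $t\in\mathcal{M}$ ($t$ a term). A ground constraint is true if all its atoms are; a constraint is satisfiable if some grounding instance of it is true. A constrained term $\Gamma\parallel s$ is a term $s$ with a constraint $\Gamma$. A (congruence) class is a finite set $A=\{\Gamma_1\parallel s_1,\dots,\Gamma_n\parallel s_n\}$ of constrained terms. Its separating variables are $X=\mathrm{vars}(s_1)\cap\dots\cap\mathrm{vars}(s_n)$;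 its free variables are $(\mathrm{vars}(s_1)\cup\dots\cup\mathrm{vars}(s_n))\setminus X$. For a substitution $\mu$, $A\mu=\{\Gamma_i\mu\parallel s_i\mu\}_i$. **Semantics.** With $X$ the separating variables of $A$: $\mathrm{gnd}'(A)=\bigcup_{\sigma\text{ ground},\,\mathrm{dom}(\sigma)=X}\{\{(\Gamma\sigma\parallel s\sigma)\mid(\Gamma\parallel s)\in A,\ \Gamma\sigma\text{ satisfiable}\}\}$ and $\mathrm{gnd}(A)=\bigcup_{B\in\mathrm{gnd}'(A)}\{\bigcup_{\sigma\text{ grounding for }B}\{s\sigma\mid(\Gamma\parallel s)\in B,\ \Gamma\sigma\text{ true}\}\}$. Thus $\mathrm{gnd}(A)$ is a set of sets of ground terms. A class $B$ subsumes a class $A$ if for every $A'\in\mathrm{gnd}(A)$ there is $B'\in\mathrm{gnd}(B)$ with $A'\subseteq B'$. **Normal class.** $\mathrm{norm}(A)=\{(\Gamma\wedge\Gamma\tau\parallel s)\mid(\Gamma\parallel s)\in A\}\cup\{(\Gamma\wedge\Gamma\tau\parallel s\tau)\mid(\Gamma\parallel s)\in A,\ s\text{ contains free variables of }A\}$, where $\tau$ is a renaming of the free variables of $A$ to fresh variables. **$\Pi$-closed.** For a set $\Pi$ of classes and a ground term $\alpha$, $\mathcal{M}$ is $\Pi$-closed for $\alpha$ if for all (sub)terms $s$ occurring in $\Pi$ and all substitutions $\sigma$ grounding for $s$: if $s\sigma\in\mathcal{M}$ then $s\delta\in\mathcal{M}$ for all $\delta$ such that whenever $x\sigma\neq x\delta$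 for a variable $x$, then $x\delta=\alpha$. **The calculus $\Rightarrow_{\mathrm{CC}(\mathcal{X})}$.** A state is a finite set of classes; different classes in a state are variable disjoint (by renaming). The initial state for $E$ is $\{\{s\in\mathcal{M}\wedge t\in\mathcal{M}\parallel s,\ \ s\in\mathcal{M}\wedge t\in\mathcal{M}\parallel t\}\mid s\approx t\in E\}\cup\{\{f(x_1,\dots,x_k)\in\mathcal{M}\parallel f(x_1,\dots,x_k)\}\mid f\in\Omega\text{ of arity }k\}$. The rules are (all unions are set unions; $A$ and $B$ may be identical in Merge and Deduction, in which case a renamed copy is used; involved classes are renamed to be variable disjoint): *Merge*: $\Pi\cup\{A,B\}\Rightarrow\Pi\cup\{A,B,(A'\cup B')\mu\}$, provided $\mathrm{norm}(A)=\{\Gamma_1\parallel s_1,\dots,\Gamma_n\parallel s_n\}$, $\mathrm{norm}(B)=\{\Delta_1\parallel t_1,\dots,\Delta_m\parallel t_m\}$, there are $(\Gamma\parallel s)\in A$, $(\Delta\parallel t)\in B$ with $\mu=\mathrm{mgu}(s,t)$, $A'=\{\Gamma_i\wedge\Gamma\wedge\Delta\parallel s_i\mid 1\le i\le n\}$, $B'=\{\Delta_j\wedge\Gamma\wedge\Delta\parallel t_j\mid 1\le j\le m\}$, and no class in $\Pi\cup\{A,B\}$ subsumes $(A'\cup B')\mu$. *Deduction*: $\Pi\cup\{A,B\}\Rightarrow\Pi\cup\{A,B,\{\Gamma'\parallel f(s'_1,\dots,s'_n),\ \Gamma'\parallel f(t'_1,\dots,t'_n)\}\mu\}$, provided $\Gamma\parallel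 f(s_1,\dots,s_n)\in A$, $\Delta\parallel f(t_1,\dots,t_n)\in B$, for each $0<i\le n$ there is $D_i\in\Pi$ with $\Gamma_i\parallel s'_i\in\mathrm{norm}(D_i)$ and $\Delta_i\parallel t'_i\in\mathrm{norm}(D_i)$, $\mu$ is a simultaneous mgu of $f(s'_1,\dots,s'_n)=f(s_1,\dots,s_n)$ and $f(t'_1,\dots,t'_n)=f(t_1,\dots,t_n)$, $\Gamma'=\Gamma\wedge\Delta\wedge\Gamma_1\wedge\dots\wedge\Gamma_n\wedge\Delta_1\wedge\dots\wedge\Delta_n$, and no class in $\Pi\cup\{A,B\}$ subsumes the new class. *Subsumption* (has precedence over the other rules): $\Pi\cup\{A,B\}\Rightarrow\Pi\cup\{B\}$, provided $A\ne B$ and $B$ subsumes $A$. A run is a sequence of rule applications starting from the initial state, continued as long as some rule is applicable. *)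

theory Defs
  imports Main "HOL-Library.Extended_Nat"
begin

section \<open>Terms and substitutions\<close>

datatype (funs_trm: 'f, vars_trm: 'v) trm =
  Var 'v
| Fun 'f "('f, 'v) trm list"

text \<open>
  A signature is a set of pairs of a function symbol and its arity. The variables are all
  elements of the type \<open>'v\<close>, which the statement assumes to be infinite.
\<close>

type_synonym 'f sig = "('f \<times> nat) set"

fun wf_trm :: "'f sig \<Rightarrow> ('f, 'v) trm \<Rightarrow> bool" where
  "wf_trm F (Var x) = True"
| "wf_trm F (Fun f ts) = ((f, length ts) \<in> F \<and> (\<forall>t\<in>set ts. wf_trm F t))"

definition terms :: "'f sig \<Rightarrow> ('f, 'v) trm set" where
  "terms F = {t. wf_trm F t}"

definition ground :: "('f, 'v) trm \<Rightarrow> bool" where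
  "ground t \<longleftrightarrow> vars_trm t = {}"

definition ground_terms :: "'f sig \<Rightarrow> ('f, 'v) trm set" where
  "ground_terms F = {t \<in> terms F. ground t}"

fun subterms :: "('f, 'v) trm \<Rightarrow> ('f, 'v) trm set" where
  "subterms (Var x) = {Var x}"
| "subterms (Fun f ts) = insert (Fun f ts) (\<Union>t\<in>set ts. subterms t)"

type_synonym ('f, 'v) subst = "'v \<Rightarrow> ('f, 'v) trm"

fun subst_trm :: "('f, 'v) trm \<Rightarrow> ('f, 'v) subst \<Rightarrow> ('f, 'v) trm" (infixl "\<cdot>" 67) where
  "Var x \<cdot> \<sigma> = \<sigma> x"
| "Fun f ts \<cdot> \<sigma> = Fun f (map (\<lambda>t. t \<cdot> \<sigma>) ts)"

definition is_subst :: "'f sig \<Rightarrow> ('f, 'v) subst \<Rightarrow> bool" where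
  "is_subst F \<sigma> \<longleftrightarrow> (\<forall>x. \<sigma> x \<in> terms F)"

definition subst_dom :: "('f, 'v) subst \<Rightarrow> 'v set" where
  "subst_dom \<sigma> = {x. \<sigma> x \<noteq> Var x}"

definition subst_range_vars :: "('f, 'v) subst \<Rightarrow> 'v set" where
  "subst_range_vars \<sigma> = (\<Union>x\<in>subst_dom \<sigma>. vars_trm (\<sigma> x))"

definition subst_comp :: "('f, 'v) subst \<Rightarrow> ('f, 'v) subst \<Rightarrow> ('f, 'v) subst" where
  "subst_comp \<sigma> \<theta> = (\<lambda>x. \<sigma> x \<cdot> \<theta>)"

definition unifies :: "('f, 'v) subst \<Rightarrow> (('f, 'v) trm \<times> ('f, 'v) trm) set \<Rightarrow> bool" where
  "unifies \<sigma> U \<longleftrightarrow> (\<forall>(s, t)\<in>U. s \<cdot> \<sigma> = t \<cdot> \<sigma>)"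

text \<open>
  Simultaneous most general unifiers of a set of term pairs. The last two conjuncts express
  that the mgu is idempotent and introduces no fresh variables.
\<close>

definition is_mgu ::
  "'f sig \<Rightarrow> ('f, 'v) subst \<Rightarrow> (('f, 'v) trm \<times> ('f, 'v) trm) set \<Rightarrow> bool" where
  "is_mgu F \<mu> U \<longleftrightarrow>
     is_subst F \<mu> \<and> unifies \<mu> U \<and>
     (\<forall>\<theta>. is_subst F \<theta> \<and> unifies \<theta> U \<longrightarrow> (\<exists>\<rho>. is_subst F \<rho> \<and> \<theta> = subst_comp \<mu> \<rho>)) \<and>
     subst_comp \<mu> \<mu> = \<mu> \<and>
     subst_range_vars \<mu> \<subseteq> (\<Union>(s, t)\<in>U. vars_trm s \<union> vars_trm t)"

definition gnd_eq ::
  "'f sig \<Rightarrow> ('f, 'v) trm set \<Rightarrow> ('f, 'v) trm \<times> ('f, 'v) trm \<Rightarrow>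
   (('f, 'v) trm \<times> ('f, 'v) trm) set" where
  "gnd_eq F M e = {(fst e \<cdot> \<sigma>, snd e \<cdot> \<sigma>) | \<sigma>.
     is_subst F \<sigma> \<and> ground (fst e \<cdot> \<sigma>) \<and> ground (snd e \<cdot> \<sigma>) \<and>
     fst e \<cdot> \<sigma> \<in> M \<and> snd e \<cdot> \<sigma> \<in> M}"


section \<open>Constrained terms and classes\<close>

text \<open>
  A constraint, i.e. a conjunction of atoms \<open>t \<in> M\<close>, is represented by the set of the terms
  \<open>t\<close>; conjunction is union. Constraints, classes and states are plain sets; those
  occurring in a run over a finite signature and finitely many equations are finite, because
  the initial state consists of finite sets and the rules preserve finiteness.
\<close>

type_synonym ('f, 'v) constr = "('f, 'v) trm set"
type_synonym ('f, 'v) cterm = "('f, 'v) constr \<times> ('f, 'v) trm"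
type_synonym ('f, 'v) cls = "('f, 'v) cterm set"
type_synonym ('f, 'v) state = "('f, 'v) cls set"

definition subst_constr :: "('f, 'v) constr \<Rightarrow> ('f, 'v) subst \<Rightarrow> ('f, 'v) constr" where
  "subst_constr \<Gamma> \<sigma> = (\<lambda>t. t \<cdot> \<sigma>) ` \<Gamma>"

definition subst_cls :: "('f, 'v) cls \<Rightarrow> ('f, 'v) subst \<Rightarrow> ('f, 'v) cls" where
  "subst_cls A \<sigma> = {(subst_constr \<Gamma> \<sigma>, s \<cdot> \<sigma>) | \<Gamma> s. (\<Gamma>, s) \<in> A}"

definition ground_constr :: "('f, 'v) constr \<Rightarrow> bool" where
  "ground_constr \<Gamma> \<longleftrightarrow> (\<forall>t\<in>\<Gamma>. ground t)"

definition constr_true :: "('f, 'v) trm set \<Rightarrow> ('f, 'v) constr \<Rightarrow> bool" where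
  "constr_true M \<Gamma> \<longleftrightarrow> (\<forall>t\<in>\<Gamma>. t \<in> M)"

definition satisfiable :: "'f sig \<Rightarrow> ('f, 'v) trm set \<Rightarrow> ('f, 'v) constr \<Rightarrow> bool" where
  "satisfiable F M \<Gamma> \<longleftrightarrow>
     (\<exists>\<sigma>. is_subst F \<sigma> \<and> ground_constr (subst_constr \<Gamma> \<sigma>) \<and> constr_true M (subst_constr \<Gamma> \<sigma>))"

definition terms_of_cls :: "('f, 'v) cls \<Rightarrow> ('f, 'v) trm set" where
  "terms_of_cls A = (\<Union>(\<Gamma>, s)\<in>A. insert s \<Gamma>)"

definition vars_cls :: "('f, 'v) cls \<Rightarrow> 'v set" where
  "vars_cls A = (\<Union>t\<in>terms_of_cls A. vars_trm t)"

text \<open>Separating and free variables ignore variables that only occur in constraints.\<close>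

definition sep_vars :: "('f, 'v) cls \<Rightarrow> 'v set" where
  "sep_vars A = (\<Inter>(\<Gamma>, s)\<in>A. vars_trm s)"

definition free_vars :: "('f, 'v) cls \<Rightarrow> 'v set" where
  "free_vars A = (\<Union>(\<Gamma>, s)\<in>A. vars_trm s) - sep_vars A"

definition grounding_cls :: "'f sig \<Rightarrow> ('f, 'v) subst \<Rightarrow> ('f, 'v) cls \<Rightarrow> bool" where
  "grounding_cls F \<sigma> A \<longleftrightarrow> is_subst F \<sigma> \<and> vars_cls (subst_cls A \<sigma>) = {}"

definition gnd' :: "'f sig \<Rightarrow> ('f, 'v) trm set \<Rightarrow> ('f, 'v) cls \<Rightarrow> ('f, 'v) cls set" where
  "gnd' F M A =
     {{(subst_constr \<Gamma> \<sigma>, s \<cdot> \<sigma>) | \<Gamma> s. (\<Gamma>, s) \<in> A \<and> satisfiable F M (subst_constr \<Gamma> \<sigma>)} | \<sigma>.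
        is_subst F \<sigma> \<and> subst_dom \<sigma> = sep_vars A \<and> (\<forall>x\<in>subst_dom \<sigma>. ground (\<sigma> x))}"

definition gnd ::
  "'f sig \<Rightarrow> ('f, 'v) trm set \<Rightarrow> ('f, 'v) cls \<Rightarrow> ('f, 'v) trm set set" where
  "gnd F M A =
     {(\<Union>\<sigma>\<in>{\<sigma>. grounding_cls F \<sigma> B}.
         {s \<cdot> \<sigma> | \<Gamma> s. (\<Gamma>, s) \<in> B \<and> constr_true M (subst_constr \<Gamma> \<sigma>)}) | B.
        B \<in> gnd' F M A}"

text \<open>\<open>subsumes F M B A\<close>: the class \<open>B\<close> subsumes the class \<open>A\<close>.\<close>

definition subsumes ::
  "'f sig \<Rightarrow> ('f, 'v) trm set \<Rightarrow> ('f, 'v) cls \<Rightarrow> ('f, 'v) cls \<Rightarrow> bool" where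
  "subsumes F M B A \<longleftrightarrow> (\<forall>A'\<in>gnd F M A. \<exists>B'\<in>gnd F M B. A' \<subseteq> B')"

definition variant :: "('f, 'v) cls \<Rightarrow> ('f, 'v) cls \<Rightarrow> bool" where
  "variant A B \<longleftrightarrow> (\<exists>\<pi>. bij \<pi> \<and> B = subst_cls A (\<lambda>x. Var (\<pi> x)))"

text \<open>
  The normal class depends on the choice of the fresh variables, hence a relation. Here the
  variables are only required to be fresh for \<open>A\<close>; the rules below additionally demand that
  the normal classes be variable disjoint from all other classes involved.
\<close>

definition is_norm :: "('f, 'v) cls \<Rightarrow> ('f, 'v) cls \<Rightarrow> bool" where
  "is_norm A N \<longleftrightarrow> (\<exists>\<tau>.
     inj_on \<tau> (free_vars A) \<and> \<tau> ` free_vars A \<inter> vars_cls A = {} \<and>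
     (\<forall>x. x \<notin> free_vars A \<longrightarrow> \<tau> x = x) \<and>
     N = {(\<Gamma> \<union> subst_constr \<Gamma> (\<lambda>x. Var (\<tau> x)), s) | \<Gamma> s. (\<Gamma>, s) \<in> A} \<union>
         {(\<Gamma> \<union> subst_constr \<Gamma> (\<lambda>x. Var (\<tau> x)), s \<cdot> (\<lambda>x. Var (\<tau> x))) | \<Gamma> s.
            (\<Gamma>, s) \<in> A \<and> vars_trm s \<inter> free_vars A \<noteq> {}})"

text \<open>
  The terms occurring in a state include those occurring in its constraints.
\<close>

definition closed_for ::
  "'f sig \<Rightarrow> ('f, 'v) trm set \<Rightarrow> ('f, 'v) state \<Rightarrow> ('f, 'v) trm \<Rightarrow> bool" where
  "closed_for F M P \<alpha> \<longleftrightarrow>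
     (\<forall>A\<in>P. \<forall>t\<in>terms_of_cls A. \<forall>s\<in>subterms t. \<forall>\<sigma>.
        is_subst F \<sigma> \<and> ground (s \<cdot> \<sigma>) \<and> s \<cdot> \<sigma> \<in> M \<longrightarrow>
        (\<forall>\<delta>. is_subst F \<delta> \<and> (\<forall>x. \<sigma> x \<noteq> \<delta> x \<longrightarrow> \<delta> x = \<alpha>) \<longrightarrow> s \<cdot> \<delta> \<in> M))"


section \<open>The calculus\<close>

definition vars_disjoint_state :: "('f, 'v) state \<Rightarrow> bool" where
  "vars_disjoint_state P \<longleftrightarrow> (\<forall>A\<in>P. \<forall>B\<in>P. A \<noteq> B \<longrightarrow> vars_cls A \<inter> vars_cls B = {})"

text \<open>
  The initial state is determined only up to the renaming that makes its classes variable
  disjoint.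
\<close>

definition init_eq_cls :: "('f, 'v) trm \<times> ('f, 'v) trm \<Rightarrow> ('f, 'v) cls" where
  "init_eq_cls e = {({fst e, snd e}, fst e), ({fst e, snd e}, snd e)}"

definition init_fun_cls :: "'f \<Rightarrow> 'v list \<Rightarrow> ('f, 'v) cls" where
  "init_fun_cls f xs = {({Fun f (map Var xs)}, Fun f (map Var xs))}"

definition initial_state ::
  "'f sig \<Rightarrow> (('f, 'v) trm \<times> ('f, 'v) trm) set \<Rightarrow> ('f, 'v) state \<Rightarrow> bool" where
  "initial_state F E P \<longleftrightarrow> (\<exists>a b.
     (\<forall>e\<in>E. variant (init_eq_cls e) (a e)) \<and>
     (\<forall>(f, k)\<in>F. \<exists>xs. length xs = k \<and> distinct xs \<and> b (f, k) = init_fun_cls f xs) \<and>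
     P = a ` E \<union> b ` F \<and> vars_disjoint_state P)"

text \<open>\<open>add_cls P C P'\<close>: adding \<open>C\<close>, renamed apart from the classes of \<open>P\<close>, gives \<open>P'\<close>.\<close>

definition add_cls :: "('f, 'v) state \<Rightarrow> ('f, 'v) cls \<Rightarrow> ('f, 'v) state \<Rightarrow> bool" where
  "add_cls P C P' \<longleftrightarrow> (\<exists>C'. variant C C' \<and> (\<forall>D\<in>P. vars_cls C' \<inter> vars_cls D = {}) \<and>
     P' = insert C' P)"

text \<open>
  In the rules, \<open>P\<close> is the whole state on the left-hand side. The classes \<open>A\<^sub>0\<close>, \<open>B\<^sub>0\<close> and
  \<open>D\<^sub>0 i\<close> are members of the state, \<open>A\<close>, \<open>B\<close> and \<open>D i\<close> the renamed copies to which the rule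
  is applied. As every variable of a class also occurs in its normal class, disjointness
  of normal classes entails disjointness of the classes.
\<close>

definition merge ::
  "'f sig \<Rightarrow> ('f, 'v) trm set \<Rightarrow> ('f, 'v) state \<Rightarrow> ('f, 'v) state \<Rightarrow> bool" where
  "merge F M P P' \<longleftrightarrow> (\<exists>A\<^sub>0 B\<^sub>0 A B NA NB \<Gamma> s \<Delta> t \<mu> A' B'.
     A\<^sub>0 \<in> P \<and> B\<^sub>0 \<in> P \<and> variant A\<^sub>0 A \<and> variant B\<^sub>0 B \<and>
     is_norm A NA \<and> is_norm B NB \<and> vars_cls NA \<inter> vars_cls NB = {} \<and>
     (\<Gamma>, s) \<in> A \<and> (\<Delta>, t) \<in> B \<and> is_mgu F \<mu> {(s, t)} \<and>
     A' = {(\<Gamma>\<^sub>i \<union> \<Gamma> \<union> \<Delta>, s\<^sub>i) | \<Gamma>\<^sub>i s\<^sub>i. (\<Gamma>\<^sub>i, s\<^sub>i) \<in> NA} \<and>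
     B' = {(\<Delta>\<^sub>j \<union> \<Gamma> \<union> \<Delta>, t\<^sub>j) | \<Delta>\<^sub>j t\<^sub>j. (\<Delta>\<^sub>j, t\<^sub>j) \<in> NB} \<and>
     (\<forall>D\<in>P. \<not> subsumes F M D (subst_cls (A' \<union> B') \<mu>)) \<and>
     add_cls P (subst_cls (A' \<union> B') \<mu>) P')"

definition deduction ::
  "'f sig \<Rightarrow> ('f, 'v) trm set \<Rightarrow> ('f, 'v) state \<Rightarrow> ('f, 'v) state \<Rightarrow> bool" where
  "deduction F M P P' \<longleftrightarrow>
    (\<exists>A\<^sub>0 B\<^sub>0 A B \<Gamma> \<Delta> f n ss ts ss' ts' D\<^sub>0 D N \<Gamma>s \<Delta>s \<mu> \<Gamma>' C.
     A\<^sub>0 \<in> P \<and> B\<^sub>0 \<in> P \<and> variant A\<^sub>0 A \<and> variant B\<^sub>0 B \<and>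
     length ss = n \<and> length ts = n \<and> length ss' = n \<and> length ts' = n \<and>
     (\<Gamma>, Fun f ss) \<in> A \<and> (\<Delta>, Fun f ts) \<in> B \<and>
     (\<forall>i<n. D\<^sub>0 i \<in> P \<and> variant (D\<^sub>0 i) (D i) \<and> is_norm (D i) (N i) \<and>
        (\<Gamma>s i, ss' ! i) \<in> N i \<and> (\<Delta>s i, ts' ! i) \<in> N i) \<and>
     vars_cls A \<inter> vars_cls B = {} \<and>
     (\<forall>i<n. vars_cls (N i) \<inter> (vars_cls A \<union> vars_cls B) = {}) \<and>
     (\<forall>i<n. \<forall>j<n. i \<noteq> j \<longrightarrow> vars_cls (N i) \<inter> vars_cls (N j) = {}) \<and>
     is_mgu F \<mu> {(Fun f ss', Fun f ss), (Fun f ts', Fun f ts)} \<and>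
     \<Gamma>' = \<Gamma> \<union> \<Delta> \<union> (\<Union>i<n. \<Gamma>s i) \<union> (\<Union>i<n. \<Delta>s i) \<and>
     C = subst_cls {(\<Gamma>', Fun f ss'), (\<Gamma>', Fun f ts')} \<mu> \<and>
     (\<forall>D\<in>P. \<not> subsumes F M D C) \<and>
     add_cls P C P')"

text \<open>
  Subsumption deletes \<open>A\<close>: its left-hand side \<open>\<Pi> \<union> {A, B}\<close> is read with \<open>A \<notin> \<Pi>\<close>, as
  otherwise it could leave the state unchanged.
\<close>

definition subsumption ::
  "'f sig \<Rightarrow> ('f, 'v) trm set \<Rightarrow> ('f, 'v) state \<Rightarrow> ('f, 'v) state \<Rightarrow> bool" where
  "subsumption F M P P' \<longleftrightarrow>
     (\<exists>A B. A \<in> P \<and> B \<in> P \<and> A \<noteq> B \<and> subsumes F M B A \<and> P' = P - {A})"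

text \<open>Subsumption has precedence over the other two rules.\<close>

definition cc_step ::
  "'f sig \<Rightarrow> ('f, 'v) trm set \<Rightarrow> ('f, 'v) state \<Rightarrow> ('f, 'v) state \<Rightarrow> bool" where
  "cc_step F M P P' \<longleftrightarrow>
     subsumption F M P P' \<or>
     ((\<nexists>Q. subsumption F M P Q) \<and> (merge F M P P' \<or> deduction F M P P'))"

text \<open>
  A run has the states \<open>P i\<close> for \<open>i \<le> N\<close>, where \<open>N\<close> is its possibly infinite number of
  steps; it may end only when no rule is applicable.
\<close>

definition cc_run ::
  "'f sig \<Rightarrow> ('f, 'v) trm set \<Rightarrow> (('f, 'v) trm \<times> ('f, 'v) trm) set \<Rightarrow>
   (nat \<Rightarrow> ('f, 'v) state) \<Rightarrow> enat \<Rightarrow> bool" where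
  "cc_run F M E P N \<longleftrightarrow>
     initial_state F E (P 0) \<and>
     (\<forall>i. enat i < N \<longrightarrow> cc_step F M (P i) (P (Suc i))) \<and>
     (\<forall>n. N = enat n \<longrightarrow> (\<nexists>Q. cc_step F M (P n) Q))"

end

theory Submission
  imports Defs
begin

text \<open>
  Every constrained term \<open>\<Gamma> \<parallel> s\<close> of a run satisfies \<open>s \<in> \<Gamma>\<close>, so that \<open>gnd A \<subseteq> Pow M\<close> for
  every class \<open>A\<close>. Consider the set of those \<open>G \<subseteq> Pow M\<close> all of whose members are contained
  in members of \<open>gnd D\<close>, for a single class \<open>D\<close> of the state. Subsumption does not shrink this
  set, whereas Merge and Deduction add to it the grounding of the new class, since that class
  is not subsumed. The set being bounded by the finite set \<open>Pow (Pow M)\<close>, a run has only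
  finitely many Merge and Deduction steps, and the remaining Subsumption steps make the finite
  state smaller.
\<close>

section \<open>Substitutions and variable renamings\<close>

lemma subst_trm_cong:
  assumes "\<And>x. x \<in> vars_trm t \<Longrightarrow> \<sigma> x = \<tau> x"
  shows "t \<cdot> \<sigma> = t \<cdot> \<tau>"
  using assms by (induction t) auto

lemma subst_trm_Var: "t \<cdot> Var = t"
  by (induction t) (auto simp: map_idI)

lemma subst_trm_ground: "ground t \<Longrightarrow> t \<cdot> \<sigma> = t"
  using subst_trm_cong[of t \<sigma> Var] by (simp add: ground_def subst_trm_Var)

lemma subst_trm_subst_trm: "t \<cdot> \<sigma> \<cdot> \<tau> = t \<cdot> (\<lambda>x. \<sigma> x \<cdot> \<tau>)"
  by (induction t) auto

lemma vars_trm_rename: "vars_trm (t \<cdot> (\<lambda>x. Var (\<pi> x))) = \<pi> ` vars_trm t"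
  by (induction t) auto

lemma Var_in_terms: "Var x \<in> terms F"
  by (simp add: terms_def)

lemma subst_constr_subst_constr:
  "subst_constr (subst_constr \<Gamma> \<sigma>) \<tau> = subst_constr \<Gamma> (\<lambda>x. \<sigma> x \<cdot> \<tau>)"
  by (simp add: subst_constr_def image_image subst_trm_subst_trm)

lemma vars_subst_cls_empty_iff:
  "vars_cls (subst_cls B \<sigma>) = {} \<longleftrightarrow>
     (\<forall>(\<Gamma>, s)\<in>B. ground (s \<cdot> \<sigma>) \<and> ground_constr (subst_constr \<Gamma> \<sigma>))"
  by (fastforce simp: vars_cls_def terms_of_cls_def subst_cls_def ground_def ground_constr_def)

section \<open>Invariance of groundings under renaming\<close>

lemma sep_vars_rename:
  assumes "bij \<pi>"
  shows "sep_vars (subst_cls A (\<lambda>x. Var (\<pi> x))) = \<pi> ` sep_vars A"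
proof -
  have "sep_vars (subst_cls A (\<lambda>x. Var (\<pi> x))) = (\<Inter>c\<in>A. \<pi> ` vars_trm (snd c))"
    by (fastforce simp: sep_vars_def subst_cls_def vars_trm_rename)
  \<comment> \<open>Injectivity lets the image commute with a nonempty intersection; surjectivity
    handles the empty class, whose separating variables are all variables.\<close>
  also have "\<dots> = \<pi> ` (\<Inter>c\<in>A. vars_trm (snd c))"
    using bij_image_INT[OF assms, of "\<lambda>c. vars_trm (snd c)" A] by simp
  finally show ?thesis
    by (simp add: sep_vars_def case_prod_beta)
qed

text \<open>The second stage of \<open>gnd\<close>, split off so that each of the two stages can be
  transported along a renaming separately.\<close>

definition gnd_of :: "'f sig \<Rightarrow> ('f, 'v) trm set \<Rightarrow> ('f, 'v) cls \<Rightarrow> ('f, 'v) trm set" where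
  "gnd_of F M B = (\<Union>\<sigma>\<in>{\<sigma>. grounding_cls F \<sigma> B}.
     {s \<cdot> \<sigma> | \<Gamma> s. (\<Gamma>, s) \<in> B \<and> constr_true M (subst_constr \<Gamma> \<sigma>)})"

lemma gnd_conv_gnd_of: "gnd F M A = gnd_of F M ` gnd' F M A"
  by (auto simp: gnd_def gnd_of_def)

text \<open>Precomposing with \<open>inv \<pi>\<close> turns a substitution for the original object
  into one for its renaming that yields the same instance. The way back is precomposition with
  \<open>\<pi>\<close>.\<close>

lemma subst_constr_rename_inverse:
  assumes "bij \<pi>"
  shows "subst_constr (subst_constr \<Gamma> (\<lambda>x. Var (\<pi> x))) (\<lambda>x. \<delta> (inv \<pi> x)) = subst_constr \<Gamma> \<delta>"
  using assms by (simp add: subst_constr_subst_constr bij_is_inj)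

lemma subst_trm_rename_inverse:
  assumes "bij \<pi>"
  shows "t \<cdot> (\<lambda>x. Var (\<pi> x)) \<cdot> (\<lambda>x. \<delta> (inv \<pi> x)) = t \<cdot> \<delta>"
  using assms by (simp add: subst_trm_subst_trm bij_is_inj)

lemma is_subst_comp_fun: "is_subst F \<sigma> \<Longrightarrow> is_subst F (\<lambda>x. \<sigma> (h x))"
  by (simp add: is_subst_def)

lemma satisfiable_rename:
  assumes "bij \<pi>"
  shows "satisfiable F M (subst_constr \<Gamma> (\<lambda>x. Var (\<pi> x))) \<longleftrightarrow> satisfiable F M \<Gamma>"
proof
  assume "satisfiable F M (subst_constr \<Gamma> (\<lambda>x. Var (\<pi> x)))"
  then obtain \<sigma> where "is_subst F \<sigma>"
    "ground_constr (subst_constr \<Gamma> (\<lambda>x. \<sigma> (\<pi> x)))" "constr_true M (subst_constr \<Gamma> (\<lambda>x. \<sigma> (\<pi> x)))"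
    by (auto simp: satisfiable_def subst_constr_subst_constr)
  then show "satisfiable F M \<Gamma>"
    using is_subst_comp_fun unfolding satisfiable_def by blast
next
  assume "satisfiable F M \<Gamma>"
  then obtain \<sigma> where "is_subst F \<sigma>"
    "ground_constr (subst_constr \<Gamma> \<sigma>)" "constr_true M (subst_constr \<Gamma> \<sigma>)"
    by (auto simp: satisfiable_def)
  then have "is_subst F (\<lambda>x. \<sigma> (inv \<pi> x)) \<and>
    ground_constr (subst_constr (subst_constr \<Gamma> (\<lambda>x. Var (\<pi> x))) (\<lambda>x. \<sigma> (inv \<pi> x))) \<and>
    constr_true M (subst_constr (subst_constr \<Gamma> (\<lambda>x. Var (\<pi> x))) (\<lambda>x. \<sigma> (inv \<pi> x)))"
    by (simp add: subst_constr_rename_inverse[OF assms] is_subst_comp_fun)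
  then show "satisfiable F M (subst_constr \<Gamma> (\<lambda>x. Var (\<pi> x)))"
    unfolding satisfiable_def by blast
qed

text \<open>This stage ranges over all grounding substitutions without a condition on their domain,
  so precomposition with \<open>\<pi>\<close> and with \<open>inv \<pi>\<close> matches the two
  sides.\<close>

lemma gnd_of_rename:
  assumes "bij \<pi>"
  shows "gnd_of F M (subst_cls B (\<lambda>x. Var (\<pi> x))) = gnd_of F M B"
proof (intro equalityI subsetI)
  fix u assume "u \<in> gnd_of F M (subst_cls B (\<lambda>x. Var (\<pi> x)))"
  then obtain \<sigma> \<Gamma> s where "is_subst F \<sigma>" "(\<Gamma>, s) \<in> B" "u = s \<cdot> (\<lambda>x. \<sigma> (\<pi> x))"
    "vars_cls (subst_cls (subst_cls B (\<lambda>x. Var (\<pi> x))) \<sigma>) = {}"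
    "constr_true M (subst_constr \<Gamma> (\<lambda>x. \<sigma> (\<pi> x)))"
    by (auto simp: gnd_of_def grounding_cls_def subst_cls_def subst_constr_subst_constr
        subst_trm_subst_trm)
  moreover from this(4) have "vars_cls (subst_cls B (\<lambda>x. \<sigma> (\<pi> x))) = {}"
    unfolding vars_subst_cls_empty_iff
    by (fastforce simp: subst_cls_def subst_constr_subst_constr subst_trm_subst_trm)
  ultimately show "u \<in> gnd_of F M B"
    using is_subst_comp_fun[of F \<sigma> \<pi>] unfolding gnd_of_def grounding_cls_def by blast
next
  fix u assume "u \<in> gnd_of F M B"
  then obtain \<sigma> \<Gamma> s where *: "is_subst F \<sigma>" "(\<Gamma>, s) \<in> B" "u = s \<cdot> \<sigma>"
    "vars_cls (subst_cls B \<sigma>) = {}" "constr_true M (subst_constr \<Gamma> \<sigma>)"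
    by (auto simp: gnd_of_def grounding_cls_def)
  let ?\<sigma> = "\<lambda>x. \<sigma> (inv \<pi> x)"
  have "grounding_cls F ?\<sigma> (subst_cls B (\<lambda>x. Var (\<pi> x)))"
    using *(1,4) is_subst_comp_fun unfolding grounding_cls_def vars_subst_cls_empty_iff
    by (fastforce simp: subst_cls_def subst_constr_rename_inverse[OF assms]
        subst_trm_rename_inverse[OF assms])
  moreover have "(subst_constr \<Gamma> (\<lambda>x. Var (\<pi> x)), s \<cdot> (\<lambda>x. Var (\<pi> x))) \<in>
      subst_cls B (\<lambda>x. Var (\<pi> x))"
    using *(2) by (auto simp: subst_cls_def)
  moreover have "u = s \<cdot> (\<lambda>x. Var (\<pi> x)) \<cdot> ?\<sigma>"
    "constr_true M (subst_constr (subst_constr \<Gamma> (\<lambda>x. Var (\<pi> x))) ?\<sigma>)"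
    using *(3,5) by (simp_all add: subst_constr_rename_inverse[OF assms]
        subst_trm_rename_inverse[OF assms])
  ultimately show "u \<in> gnd_of F M (subst_cls B (\<lambda>x. Var (\<pi> x)))"
    unfolding gnd_of_def by blast
qed

text \<open>Here the domain of the substitution must be exactly the set of separating variables, and
  precomposition with \<open>inv \<pi>\<close> alone would move variables outside it. So
  \<open>\<sigma>\<close> is conjugated by the renaming.\<close>

lemma gnd'_rename:
  assumes "bij \<pi>" "B \<in> gnd' F M A"
  shows "subst_cls B (\<lambda>x. Var (\<pi> x)) \<in> gnd' F M (subst_cls A (\<lambda>x. Var (\<pi> x)))"
proof -
  let ?\<pi> = "\<lambda>x. Var (\<pi> x)"
  from assms(2) obtain \<sigma> where \<sigma>: "is_subst F \<sigma>" "subst_dom \<sigma> = sep_vars A"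
      "\<forall>x\<in>subst_dom \<sigma>. ground (\<sigma> x)"
    and B: "B = {(subst_constr \<Gamma> \<sigma>, s \<cdot> \<sigma>) | \<Gamma> s.
      (\<Gamma>, s) \<in> A \<and> satisfiable F M (subst_constr \<Gamma> \<sigma>)}"
    unfolding gnd'_def by blast
  have inv: "inv \<pi> (\<pi> x) = x" "\<pi> (inv \<pi> x) = x" for x
    using assms(1) by (simp_all add: bij_is_inj bij_is_surj surj_f_inv_f)
  define \<theta> where "\<theta> = (\<lambda>x. \<sigma> (inv \<pi> x) \<cdot> ?\<pi>)"
  \<comment> \<open>The trailing renaming leaves the ground values of \<open>\<sigma>\<close> alone
    and, outside the domain, turns \<open>Var (inv \<pi> x)\<close> back into
    \<open>Var x\<close>.\<close>
  have \<theta>: "\<theta> x = (if inv \<pi> x \<in> sep_vars A then \<sigma> (inv \<pi> x) else Var x)" for x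
    using \<sigma>(2,3) inv by (auto simp: \<theta>_def subst_dom_def subst_trm_ground)
  have comm: "(\<lambda>x. ?\<pi> x \<cdot> \<theta>) = (\<lambda>x. \<sigma> x \<cdot> ?\<pi>)"
    by (simp add: \<theta>_def inv)
  have "subst_cls B ?\<pi> = {(subst_constr (subst_constr \<Gamma> \<sigma>) ?\<pi>, s \<cdot> \<sigma> \<cdot> ?\<pi>) | \<Gamma> s.
      (\<Gamma>, s) \<in> A \<and> satisfiable F M (subst_constr (subst_constr \<Gamma> \<sigma>) ?\<pi>)}"
    unfolding B satisfiable_rename[OF assms(1)] subst_cls_def by blast
  also have "\<dots> = {(subst_constr (subst_constr \<Gamma> ?\<pi>) \<theta>, s \<cdot> ?\<pi> \<cdot> \<theta>) | \<Gamma> s.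
      (\<Gamma>, s) \<in> A \<and> satisfiable F M (subst_constr (subst_constr \<Gamma> ?\<pi>) \<theta>)}"
    unfolding subst_constr_subst_constr subst_trm_subst_trm comm ..
  also have "\<dots> = {(subst_constr \<Gamma> \<theta>, s \<cdot> \<theta>) | \<Gamma> s.
      (\<Gamma>, s) \<in> subst_cls A ?\<pi> \<and> satisfiable F M (subst_constr \<Gamma> \<theta>)}"
    unfolding subst_cls_def by blast
  finally have eq: "subst_cls B ?\<pi> = \<dots>" .
  \<comment> \<open>A ground value is never a variable, so no element of the intended domain is
    lost.\<close>
  have "\<theta> x \<noteq> Var x \<longleftrightarrow> inv \<pi> x \<in> sep_vars A" for x
    using \<sigma>(2,3) by (auto simp: \<theta> ground_def)
  then have "subst_dom \<theta> = \<pi> ` sep_vars A"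
    using inv by (auto simp: subst_dom_def image_iff) metis
  then have "subst_dom \<theta> = sep_vars (subst_cls A ?\<pi>)"
    by (simp add: sep_vars_rename[OF assms(1)])
  moreover have "is_subst F \<theta>"
    using \<sigma>(1) by (simp add: is_subst_def \<theta> Var_in_terms)
  moreover have "\<forall>x\<in>subst_dom \<theta>. ground (\<theta> x)"
    using \<sigma>(2,3) by (auto simp: \<theta> subst_dom_def)
  ultimately show ?thesis
    unfolding gnd'_def using eq by blast
qed

text \<open>Renaming a member of \<open>gnd' F M A\<close> gives a member of
  \<open>gnd' F M A'\<close> with the same \<open>gnd_of\<close>. One inclusion suffices later:
  whatever subsumes the variant \<open>A'\<close> then also subsumes \<open>A\<close>.\<close>

lemma gnd_variant_subset:
  assumes "variant A A'"
  shows "gnd F M A \<subseteq> gnd F M A'"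
proof -
  from assms obtain \<pi> where \<pi>: "bij \<pi>" "A' = subst_cls A (\<lambda>x. Var (\<pi> x))"
    by (auto simp: variant_def)
  have "gnd_of F M B \<in> gnd_of F M ` gnd' F M A'" if "B \<in> gnd' F M A" for B
    using gnd'_rename[OF \<pi>(1) that] gnd_of_rename[OF \<pi>(1), of F M B, symmetric] \<pi>(2) by simp
  then show ?thesis
    unfolding gnd_conv_gnd_of by blast
qed

section \<open>Self-constrained classes\<close>

definition self_constrained :: "('f, 'v) cls \<Rightarrow> bool" where
  "self_constrained A \<longleftrightarrow> (\<forall>(\<Gamma>, s)\<in>A. s \<in> \<Gamma>)"

lemma self_constrained_subst: "self_constrained A \<Longrightarrow> self_constrained (subst_cls A \<sigma>)"
  by (fastforce simp: self_constrained_def subst_cls_def subst_constr_def)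

lemma self_constrained_variant: "variant A A' \<Longrightarrow> self_constrained A \<Longrightarrow> self_constrained A'"
  by (auto simp: variant_def self_constrained_subst)

text \<open>The conjoined constraint contains both copies: \<open>s\<close> lies in its first half,
  the renamed \<open>s\<close> in its second.\<close>

lemma self_constrained_norm: "is_norm A N \<Longrightarrow> self_constrained A \<Longrightarrow> self_constrained N"
  by (fastforce simp: is_norm_def self_constrained_def subst_constr_def)

text \<open>A ground instance of \<open>s\<close> contributes only if the instantiated constraint is
  true, and one atom of that constraint is the instance itself.\<close>

lemma gnd_self_constrained: "self_constrained A \<Longrightarrow> gnd F M A \<subseteq> Pow M"
  by (fastforce simp: gnd_def gnd'_def self_constrained_def constr_true_def subst_constr_def)

lemma self_constrained_initial:
  assumes "initial_state F E P" "A \<in> P"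
  shows "self_constrained A"
proof -
  have "self_constrained (init_eq_cls e :: ('f, 'v) cls)" "self_constrained (init_fun_cls f xs)"
    for e :: "('f, 'v) trm \<times> ('f, 'v) trm" and f and xs :: "'v list"
    by (simp_all add: self_constrained_def init_eq_cls_def init_fun_cls_def)
  then show ?thesis
    using assms self_constrained_variant unfolding initial_state_def by fastforce
qed

lemma finite_initial: "initial_state F E P \<Longrightarrow> finite F \<Longrightarrow> finite E \<Longrightarrow> finite P"
  by (auto simp: initial_state_def)

section \<open>Merge and Deduction as additions of an unsubsumed class\<close>

definition added_unsubsumed ::
  "'f sig \<Rightarrow> ('f, 'v) trm set \<Rightarrow> ('f, 'v) state \<Rightarrow> ('f, 'v) state \<Rightarrow> bool" where
  "added_unsubsumed F M P P' \<longleftrightarrow>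
     (\<exists>C. P' = insert C P \<and> self_constrained C \<and> (\<forall>D\<in>P. \<not> subsumes F M D C))"

lemma added_unsubsumedI:
  assumes "add_cls P C P'" "self_constrained C" "\<forall>D\<in>P. \<not> subsumes F M D C"
  shows "added_unsubsumed F M P P'"
proof -
  from assms(1) obtain C' where C': "variant C C'" "P' = insert C' P"
    by (auto simp: add_cls_def)
  have "\<not> subsumes F M D C'" if "D \<in> P" for D
    using assms(3) gnd_variant_subset[OF C'(1), of F M] that unfolding subsumes_def by blast
  then show ?thesis
    using C' self_constrained_variant assms(2) unfolding added_unsubsumed_def by blast
qed

lemma merge_added:
  assumes "merge F M P P'" "\<forall>A\<in>P. self_constrained A"
  shows "added_unsubsumed F M P P'"
proof -
  from assms(1) obtain A\<^sub>0 B\<^sub>0 A B NA NB \<Gamma> \<Delta> \<mu> A' B' where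
    P: "A\<^sub>0 \<in> P" "B\<^sub>0 \<in> P" "variant A\<^sub>0 A" "variant B\<^sub>0 B" "is_norm A NA" "is_norm B NB"
    and A': "A' = {(\<Gamma>\<^sub>i \<union> \<Gamma> \<union> \<Delta>, s\<^sub>i) | \<Gamma>\<^sub>i s\<^sub>i. (\<Gamma>\<^sub>i, s\<^sub>i) \<in> NA}"
    and B': "B' = {(\<Delta>\<^sub>j \<union> \<Gamma> \<union> \<Delta>, t\<^sub>j) | \<Delta>\<^sub>j t\<^sub>j. (\<Delta>\<^sub>j, t\<^sub>j) \<in> NB}"
    and C: "\<forall>D\<in>P. \<not> subsumes F M D (subst_cls (A' \<union> B') \<mu>)"
      "add_cls P (subst_cls (A' \<union> B') \<mu>) P'"
    unfolding merge_def by blast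
  have "self_constrained NA" "self_constrained NB"
    using P assms(2) self_constrained_variant self_constrained_norm by blast+
  \<comment> \<open>Merge only enlarges the constraints of the normal classes and keeps their
    terms.\<close>
  then have "self_constrained (A' \<union> B')"
    by (auto simp: A' B' self_constrained_def)
  then show ?thesis
    using C added_unsubsumedI self_constrained_subst by blast
qed

text \<open>The new terms \<open>Fun f ss'\<close> and \<open>Fun f ts'\<close> need not occur in
  \<open>\<Gamma>'\<close>, but the premises \<open>Fun f ss\<close> and \<open>Fun f ts\<close> do,
  and \<open>\<mu>\<close> identifies them pairwise. The invariant is thus obtained after applying
  \<open>\<mu>\<close>.\<close>

lemma deduction_added:
  fixes P P' :: "('f, 'v) state"
  assumes "deduction F M P P'" "\<forall>A\<in>P. self_constrained A"
  shows "added_unsubsumed F M P P'"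
  using assms(1) unfolding deduction_def
proof (elim exE conjE)
  fix A\<^sub>0 B\<^sub>0 A B \<Gamma> \<Delta> f n ss ts ss' ts'
    and \<Gamma>s \<Delta>s :: "nat \<Rightarrow> ('f, 'v) constr" and \<mu> \<Gamma>' C
  assume P: "A\<^sub>0 \<in> P" "B\<^sub>0 \<in> P" "variant A\<^sub>0 A" "variant B\<^sub>0 B"
    "(\<Gamma>, Fun f ss) \<in> A" "(\<Delta>, Fun f ts) \<in> B"
    and \<mu>: "is_mgu F \<mu> {(Fun f ss', Fun f ss), (Fun f ts', Fun f ts)}"
    and \<Gamma>': "\<Gamma>' = \<Gamma> \<union> \<Delta> \<union> (\<Union>i<n. \<Gamma>s i) \<union> (\<Union>i<n. \<Delta>s i)"
    and C: "C = subst_cls {(\<Gamma>', Fun f ss'), (\<Gamma>', Fun f ts')} \<mu>"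
      "\<forall>D\<in>P. \<not> subsumes F M D C" "add_cls P C P'"
  have "self_constrained A" "self_constrained B"
    using P(1-4) assms(2) self_constrained_variant by blast+
  then have "Fun f ss \<in> \<Gamma>'" "Fun f ts \<in> \<Gamma>'"
    using P(5,6) unfolding self_constrained_def \<Gamma>' by auto
  moreover have "Fun f ss' \<cdot> \<mu> = Fun f ss \<cdot> \<mu>" "Fun f ts' \<cdot> \<mu> = Fun f ts \<cdot> \<mu>"
    using \<mu> unfolding is_mgu_def unifies_def by blast+
  ultimately have "Fun f ss' \<cdot> \<mu> \<in> subst_constr \<Gamma>' \<mu>" "Fun f ts' \<cdot> \<mu> \<in> subst_constr \<Gamma>' \<mu>"
    unfolding subst_constr_def by (metis imageI)+
  then have "self_constrained C"
    unfolding self_constrained_def C(1) subst_cls_def by blast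
  then show "added_unsubsumed F M P P'"
    using C(2,3) added_unsubsumedI by blast
qed

section \<open>The subsumption preorder and covered families\<close>

definition covers :: "'a set set \<Rightarrow> 'a set set \<Rightarrow> bool" where
  "covers H G \<longleftrightarrow> (\<forall>A\<in>G. \<exists>B\<in>H. A \<subseteq> B)"

text \<open>Subsumption is the pullback along \<open>gnd\<close> of the lower (Hoare) preorder on
  families of sets.\<close>

lemma subsumes_iff_covers: "subsumes F M B A \<longleftrightarrow> covers (gnd F M B) (gnd F M A)"
  by (simp add: subsumes_def covers_def)

lemma covers_refl: "covers G G"
  by (auto simp: covers_def)

lemma covers_trans: "covers I H \<Longrightarrow> covers H G \<Longrightarrow> covers I G"
  unfolding covers_def by (meson subset_trans)

definition covered ::
  "'f sig \<Rightarrow> ('f, 'v) trm set \<Rightarrow> ('f, 'v) state \<Rightarrow> ('f, 'v) trm set set set" where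
  "covered F M P = {G \<in> Pow (Pow M). \<exists>D\<in>P. covers (gnd F M D) G}"

lemma covered_subsumption:
  assumes "subsumption F M P P'"
  shows "covered F M P \<subseteq> covered F M P'"
proof -
  from assms obtain A B where
    AB: "B \<in> P'" "covers (gnd F M B) (gnd F M A)" "P' = P - {A}"
    unfolding subsumption_def subsumes_iff_covers by blast
  \<comment> \<open>If the covering class is the deleted \<open>A\<close>, then \<open>B\<close>,
    which survives because \<open>A\<close> and \<open>B\<close> differ, takes over by
    transitivity.\<close>
  have "\<exists>D'\<in>P'. covers (gnd F M D') G" if "D \<in> P" "covers (gnd F M D) G" for D G
    using AB that covers_trans by (cases "D = A") blast+
  then show ?thesis
    unfolding covered_def by blast
qed

text \<open>The grounding of the new class witnesses strictness: it covers itself, and no old class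
  covers it.\<close>

lemma covered_added:
  assumes "added_unsubsumed F M P P'"
  shows "covered F M P \<subset> covered F M P'"
proof -
  from assms obtain C where C: "P' = insert C P" "self_constrained C"
    "\<forall>D\<in>P. \<not> covers (gnd F M D) (gnd F M C)"
    unfolding added_unsubsumed_def subsumes_iff_covers by blast
  have "gnd F M C \<in> covered F M P'"
    using C(1) gnd_self_constrained[OF C(2)] covers_refl by (auto simp: covered_def)
  moreover have "gnd F M C \<notin> covered F M P"
    using C(3) by (simp add: covered_def)
  moreover have "covered F M P \<subseteq> covered F M P'"
    using C(1) by (auto simp: covered_def)
  ultimately show ?thesis
    by blast
qed

section \<open>Termination measure\<close>

lemma cc_step_cases:
  assumes "cc_step F M P P'" "\<forall>A\<in>P. self_constrained A"
  obtains "subsumption F M P P'" | "added_unsubsumed F M P P'"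
  using assms merge_added deduction_added unfolding cc_step_def by blast

lemma cc_step_invariant:
  assumes "cc_step F M P P'" "finite P" "\<forall>A\<in>P. self_constrained A"
  shows "finite P' \<and> (\<forall>A\<in>P'. self_constrained A)"
  using assms(1,3)
  by (rule cc_step_cases) (use assms in \<open>auto simp: subsumption_def added_unsubsumed_def\<close>)

lemma cc_step_measure_decreases:
  assumes "finite M" "finite P" "\<forall>A\<in>P. self_constrained A" "cc_step F M P P'"
  \<comment> \<open>Counting the families not yet covered turns growth into descent. The size of the
    state comes second because additions may increase it, while a Subsumption step may leave the
    first component unchanged.\<close>
  defines "cost \<equiv> \<lambda>P. (card (Pow (Pow M) - covered F M P), card P)"
  shows "(cost P', cost P) \<in> less_than <*lex*> less_than"
proof -
  have fin: "finite (Pow (Pow M) - covered F M P)"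
    using assms(1) by simp
  from assms(4,3) show ?thesis
  proof (rule cc_step_cases)
    assume sub: "subsumption F M P P'"
    then have "card P' < card P"
      using assms(2) unfolding subsumption_def by (metis card_Diff1_less)
    moreover have "card (Pow (Pow M) - covered F M P') \<le> card (Pow (Pow M) - covered F M P)"
      using covered_subsumption[OF sub] fin by (intro card_mono) blast+
    ultimately show ?thesis
      by (auto simp: cost_def)
  next
    assume "added_unsubsumed F M P P'"
    then have "covered F M P \<subset> covered F M P'"
      by (rule covered_added)
    moreover have "covered F M P' \<subseteq> Pow (Pow M)"
      by (auto simp: covered_def)
    ultimately have "card (Pow (Pow M) - covered F M P') < card (Pow (Pow M) - covered F M P)"
      using fin by (intro psubset_card_mono) blast+
    then show ?thesis
      by (simp add: cost_def)
  qed
qed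

theorem lemma17:
  fixes F :: "('f \<times> nat) set"
    and M :: "('f, 'v) trm set"
    and E :: "(('f, 'v) trm \<times> ('f, 'v) trm) set"
    and P :: "nat \<Rightarrow> ('f, 'v) state"
    and N :: enat
    and \<alpha> :: "('f, 'v) trm"
  assumes "infinite (UNIV :: 'v set)"
    and "finite F" and "\<exists>c. (c, 0) \<in> F" and "\<exists>f k. (f, k) \<in> F \<and> k > 0"
    and "finite M" and "M \<subseteq> ground_terms F"
    and "finite E" and "E \<subseteq> terms F \<times> terms F"
    and "\<forall>e\<in>E. gnd_eq F M e \<noteq> {}"
    and "cc_run F M E P N"
    and "\<alpha> \<in> M"
    and "\<forall>i. enat i \<le> N \<longrightarrow> closed_for F M (P i) \<alpha>"
  shows "\<exists>n. enat n \<le> N \<and> (\<nexists>Q. cc_step F M (P n) Q)"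
proof (cases N)
  \<comment> \<open>A finite run ends, by definition, in a state where no rule is applicable; it
    remains to refute an infinite one.\<close>
  case (enat n)
  then show ?thesis
    using assms(10) by (auto simp: cc_run_def)
next
  case infinity
  then have init: "initial_state F E (P 0)" and step: "\<And>i. cc_step F M (P i) (P (Suc i))"
    using assms(10) by (auto simp: cc_run_def)
  have inv: "finite (P i) \<and> (\<forall>A\<in>P i. self_constrained A)" for i
  proof (induction i)
    case 0
    then show ?case
      using finite_initial[OF init assms(2,7)] self_constrained_initial[OF init] by blast
  next
    case (Suc i)
    then show ?case
      using cc_step_invariant[OF step] by blast
  qed
  define cost where "cost = (\<lambda>P. (card (Pow (Pow M) - covered F M P), card P))"
  have "(cost (P (Suc i)), cost (P i)) \<in> less_than <*lex*> less_than" for i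
    using cc_step_measure_decreases[OF assms(5) _ _ step] inv unfolding cost_def by blast
  then have "\<exists>f. \<forall>i. (f (Suc i), f i) \<in> less_than <*lex*> less_than"
    by (intro exI[of _ "\<lambda>i. cost (P i)"]) simp
  moreover have "wf (less_than <*lex*> less_than)"
    by blast
  ultimately have False
    unfolding wf_iff_no_infinite_down_chain by blast
  then show ?thesis ..
qed

end
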